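(* Let $X$ and $Y$ be finitely copresented Esakia spaces and let $g\colon X\to Y$ be a continuous p-morphism. Then $g$ is an open map, i.e. $g(U)$ is open in $Y$ for every open subset $U\subseteq X$.
   Context: For a poset $(X,\leq)$ and $S\subseteq X$, write $\uparrow S=\{x'\in X\mid \exists x\in S,\ x\leq x'\}$ and $\downarrow S=\{x'\in X\mid \exists x\in S,\ x'\leq x\}$. An Esakia space is a compact topological space $X$ equipped with a partial order $\leq$ such that: (i) whenever $x\not\leq y$ in $X$, there is a clopen up-set $U\subseteq X$ with $x\in U$ and $y\notin U$; and (ii) $\downarrow C$ is clopen whenever $C\subseteq X$ is clopen. The clopen up-sets of an Esakia space form a Heyting algebra (under union, intersection, and $U\to V=(\downarrow(U\setminus V))^c$). A map $g\colon X\to Y$ between posets is a p-morphism if $\downarrow g^{-1}(S)=g^{-1}(\downarrow S)$ for every $S\subseteq Y$; equivalently, $g(\uparrow\{x\})=\uparrow\{g(x)\}$ for every $x\in X$. A Heyting algebra is finitely presented if it is (isomorphic to) the quotient of a free Heyting algebra on a finite set of generators by a finitely generated congruence. An Esakia space is finitely copresented if its Heyting algebra of clopen up-sets is finitely presented. *)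

theory Defs
  imports "HOL-Analysis.Analysis"
begin

section \<open>Heyting algebras\<close>

record 'a heyting =
  hcarrier :: "'a set"
  hbot :: 'a
  htop :: 'a
  hmeet :: "'a \<Rightarrow> 'a \<Rightarrow> 'a"
  hjoin :: "'a \<Rightarrow> 'a \<Rightarrow> 'a"
  himp :: "'a \<Rightarrow> 'a \<Rightarrow> 'a"

definition hclosed :: "'a heyting \<Rightarrow> bool" where
  "hclosed H \<longleftrightarrow> hbot H \<in> hcarrier H \<and> htop H \<in> hcarrier H \<and>
     (\<forall>a\<in>hcarrier H. \<forall>b\<in>hcarrier H.
        hmeet H a b \<in> hcarrier H \<and> hjoin H a b \<in> hcarrier H \<and> himp H a b \<in> hcarrier H)"

definition hle :: "'a heyting \<Rightarrow> 'a \<Rightarrow> 'a \<Rightarrow> bool" where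
  "hle H a b \<longleftrightarrow> hmeet H a b = a"

definition heyting_algebra :: "'a heyting \<Rightarrow> bool" where
  "heyting_algebra H \<longleftrightarrow> hclosed H \<and>
     (\<forall>a\<in>hcarrier H. \<forall>b\<in>hcarrier H. \<forall>c\<in>hcarrier H.
        hmeet H a b = hmeet H b a \<and> hjoin H a b = hjoin H b a \<and>
        hmeet H a (hmeet H b c) = hmeet H (hmeet H a b) c \<and>
        hjoin H a (hjoin H b c) = hjoin H (hjoin H a b) c \<and>
        hmeet H a (hjoin H a b) = a \<and> hjoin H a (hmeet H a b) = a \<and>
        hmeet H a (htop H) = a \<and> hjoin H a (hbot H) = a \<and>
        (hle H (hmeet H c a) b \<longleftrightarrow> hle H c (himp H a b)))"

definition hhom :: "'a heyting \<Rightarrow> 'b heyting \<Rightarrow> ('a \<Rightarrow> 'b) \<Rightarrow> bool" where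
  "hhom H K f \<longleftrightarrow> f \<in> hcarrier H \<rightarrow> hcarrier K \<and>
     f (hbot H) = hbot K \<and> f (htop H) = htop K \<and>
     (\<forall>a\<in>hcarrier H. \<forall>b\<in>hcarrier H.
        f (hmeet H a b) = hmeet K (f a) (f b) \<and>
        f (hjoin H a b) = hjoin K (f a) (f b) \<and>
        f (himp H a b) = himp K (f a) (f b))"

definition hisomorphic :: "'a heyting \<Rightarrow> 'b heyting \<Rightarrow> bool" where
  "hisomorphic H K \<longleftrightarrow> (\<exists>f. hhom H K f \<and> bij_betw f (hcarrier H) (hcarrier K))"

definition hcong :: "'a heyting \<Rightarrow> 'a rel \<Rightarrow> bool" where
  "hcong H \<theta> \<longleftrightarrow> equiv (hcarrier H) \<theta> \<and>
     (\<forall>a a' b b'. (a, a') \<in> \<theta> \<longrightarrow> (b, b') \<in> \<theta> \<longrightarrow>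
        (hmeet H a b, hmeet H a' b') \<in> \<theta> \<and>
        (hjoin H a b, hjoin H a' b') \<in> \<theta> \<and>
        (himp H a b, himp H a' b') \<in> \<theta>)"

definition hquot :: "'a heyting \<Rightarrow> 'a rel \<Rightarrow> 'a set heyting" where
  "hquot H \<theta> = \<lparr>
     hcarrier = hcarrier H // \<theta>,
     hbot = \<theta> `` {hbot H},
     htop = \<theta> `` {htop H},
     hmeet = (\<lambda>A B. \<Union>a\<in>A. \<Union>b\<in>B. \<theta> `` {hmeet H a b}),
     hjoin = (\<lambda>A B. \<Union>a\<in>A. \<Union>b\<in>B. \<theta> `` {hjoin H a b}),
     himp = (\<lambda>A B. \<Union>a\<in>A. \<Union>b\<in>B. \<theta> `` {himp H a b})\<rparr>"

definition hcong_gen :: "'a heyting \<Rightarrow> 'a rel \<Rightarrow> 'a rel" where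
  "hcong_gen H E = \<Inter>{\<theta>. hcong H \<theta> \<and> E \<subseteq> \<theta>}"


section \<open>Free and finitely presented Heyting algebras\<close>

datatype 'v hterm =
    Var 'v
  | Bot
  | Top
  | Meet "'v hterm" "'v hterm"
  | Join "'v hterm" "'v hterm"
  | Imp "'v hterm" "'v hterm"

definition term_algebra :: "'v set \<Rightarrow> 'v hterm heyting" where
  "term_algebra S = \<lparr>hcarrier = {t. set_hterm t \<subseteq> S},
     hbot = Bot, htop = Top, hmeet = Meet, hjoin = Join, himp = Imp\<rparr>"

text \<open>The least congruence on terms whose quotient is a Heyting algebra.
  That this quotient is free on \<open>S\<close> is shown in \<open>free_heyting_heyting_algebra\<close>
  and \<open>free_heyting_universal\<close> below.\<close>

definition heyting_cong :: "'v set \<Rightarrow> 'v hterm rel" where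
  "heyting_cong S =
     \<Inter>{\<theta>. hcong (term_algebra S) \<theta> \<and> heyting_algebra (hquot (term_algebra S) \<theta>)}"

definition free_heyting :: "'v set \<Rightarrow> 'v hterm set heyting" where
  "free_heyting S = hquot (term_algebra S) (heyting_cong S)"

definition free_gen :: "'v set \<Rightarrow> 'v \<Rightarrow> 'v hterm set" where
  "free_gen S v = heyting_cong S `` {Var v}"

text \<open>Every finite generating set is in bijection with a finite set of natural numbers,
  so nothing is lost by drawing the generators from \<^typ>\<open>nat\<close>.\<close>

definition finitely_presented :: "'a heyting \<Rightarrow> bool" where
  "finitely_presented H \<longleftrightarrow>
     (\<exists>(S :: nat set) E. finite S \<and> finite E \<and>
        E \<subseteq> hcarrier (free_heyting S) \<times> hcarrier (free_heyting S) \<and>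
        hisomorphic H (hquot (free_heyting S) (hcong_gen (free_heyting S) E)))"


section \<open>Esakia spaces\<close>

text \<open>The order on \<open>X\<close> is a set of pairs; \<open>\<up>S\<close> and \<open>\<down>S\<close> are the images of \<open>S\<close>
  under the order and its converse.\<close>

abbreviation (input) up :: "'a rel \<Rightarrow> 'a set \<Rightarrow> 'a set" where
  "up r S \<equiv> r `` S"

abbreviation (input) down :: "'a rel \<Rightarrow> 'a set \<Rightarrow> 'a set" where
  "down r S \<equiv> r\<inverse> `` S"

definition clopenin :: "'a topology \<Rightarrow> 'a set \<Rightarrow> bool" where
  "clopenin X U \<longleftrightarrow> openin X U \<and> closedin X U"

definition clopen_upset :: "'a topology \<Rightarrow> 'a rel \<Rightarrow> 'a set \<Rightarrow> bool" where
  "clopen_upset X r U \<longleftrightarrow> clopenin X U \<and> up r U \<subseteq> U"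

definition esakia_space :: "'a topology \<Rightarrow> 'a rel \<Rightarrow> bool" where
  "esakia_space X r \<longleftrightarrow> compact_space X \<and> partial_order_on (topspace X) r \<and>
     (\<forall>x\<in>topspace X. \<forall>y\<in>topspace X. (x, y) \<notin> r \<longrightarrow>
        (\<exists>U. clopen_upset X r U \<and> x \<in> U \<and> y \<notin> U)) \<and>
     (\<forall>C. clopenin X C \<longrightarrow> clopenin X (down r C))"

definition upset_algebra :: "'a topology \<Rightarrow> 'a rel \<Rightarrow> 'a set heyting" where
  "upset_algebra X r = \<lparr>hcarrier = {U. clopen_upset X r U},
     hbot = {}, htop = topspace X, hmeet = (\<inter>), hjoin = (\<union>),
     himp = (\<lambda>U V. topspace X - down r (U - V))\<rparr>"

definition finitely_copresented :: "'a topology \<Rightarrow> 'a rel \<Rightarrow> bool" where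
  "finitely_copresented X r \<longleftrightarrow> finitely_presented (upset_algebra X r)"

definition p_morphism ::
  "'a topology \<Rightarrow> 'a rel \<Rightarrow> 'b topology \<Rightarrow> 'b rel \<Rightarrow> ('a \<Rightarrow> 'b) \<Rightarrow> bool" where
  "p_morphism X r Y s g \<longleftrightarrow> g \<in> topspace X \<rightarrow> topspace Y \<and>
     (\<forall>S\<subseteq>topspace Y. down r (g -` S \<inter> topspace X) = g -` (down s S) \<inter> topspace X)"


section \<open>The constructions are as intended\<close>

lemma upset_algebra_heyting_algebra:
  assumes "esakia_space X r"
  shows "heyting_algebra (upset_algebra X r)"
proof -
  have sub: "r \<subseteq> topspace X \<times> topspace X" and refl: "\<And>x. x \<in> topspace X \<Longrightarrow> (x, x) \<in> r"
    and tr: "trans r"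
    using assms by (auto simp: esakia_space_def partial_order_on_def preorder_on_def refl_on_def)
  have dn: "clopenin X (down r C)" if "clopenin X C" for C
    using assms that by (auto simp: esakia_space_def)
  have le: "hle (upset_algebra X r) U V \<longleftrightarrow> U \<subseteq> V" for U V
    by (auto simp: hle_def upset_algebra_def)
  have subX: "U \<subseteq> topspace X" if "clopen_upset X r U" for U
    using that by (auto simp: clopen_upset_def clopenin_def dest: openin_subset)
  have imp: "clopen_upset X r (topspace X - down r (U - V))"
    if "clopen_upset X r U" "clopen_upset X r V" for U V
  proof -
    have "clopenin X (topspace X - down r (U - V))"
      using dn[of "U - V"] that by (auto simp: clopen_upset_def clopenin_def)
    moreover have "up r (topspace X - down r (U - V)) \<subseteq> topspace X - down r (U - V)"
    proof
      fix y assume "y \<in> up r (topspace X - down r (U - V))"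
      then obtain x where x: "x \<notin> down r (U - V)" "(x, y) \<in> r" by auto
      then have "y \<notin> down r (U - V)" using transD[OF tr x(2)] by blast
      then show "y \<in> topspace X - down r (U - V)" using x sub by auto
    qed
    ultimately show ?thesis by (simp add: clopen_upset_def)
  qed
  have cl: "hclosed (upset_algebra X r)"
    unfolding hclosed_def using imp sub
    by (auto simp: upset_algebra_def clopen_upset_def clopenin_def)
  have res: "W \<inter> U \<subseteq> V \<longleftrightarrow> W \<subseteq> topspace X - down r (U - V)"
    if "clopen_upset X r U" "clopen_upset X r V" "clopen_upset X r W" for U V W
  proof
    assume "W \<inter> U \<subseteq> V"
    then show "W \<subseteq> topspace X - down r (U - V)"
      using that(3) subX[OF that(3)] by (auto simp: clopen_upset_def)
  next
    assume "W \<subseteq> topspace X - down r (U - V)"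
    then show "W \<inter> U \<subseteq> V"
      using subX[OF that(1)] refl by auto
  qed
  show ?thesis
    unfolding heyting_algebra_def le using cl res subX
    by (simp add: upset_algebra_def) blast
qed

lemma hcong_class_eq_iff:
  assumes "hcong H \<theta>" "a \<in> hcarrier H" "b \<in> hcarrier H"
  shows "\<theta> `` {a} = \<theta> `` {b} \<longleftrightarrow> (a, b) \<in> \<theta>"
  using assms eq_equiv_class_iff[of "hcarrier H" \<theta> a b] by (auto simp: hcong_def)

lemma hquot_ops:
  assumes "hcong H \<theta>" "a \<in> hcarrier H" "b \<in> hcarrier H"
  shows "hmeet (hquot H \<theta>) (\<theta> `` {a}) (\<theta> `` {b}) = \<theta> `` {hmeet H a b}"
    and "hjoin (hquot H \<theta>) (\<theta> `` {a}) (\<theta> `` {b}) = \<theta> `` {hjoin H a b}"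
    and "himp (hquot H \<theta>) (\<theta> `` {a}) (\<theta> `` {b}) = \<theta> `` {himp H a b}"
proof -
  have e: "equiv (hcarrier H) \<theta>" using assms by (simp add: hcong_def)
  have *: "(\<Union>a\<in>\<theta> `` {a}. \<Union>b\<in>\<theta> `` {b}. \<theta> `` {f a b}) = \<theta> `` {f a b}"
    if f: "\<And>a a' b b'. (a, a') \<in> \<theta> \<Longrightarrow> (b, b') \<in> \<theta> \<Longrightarrow> (f a b, f a' b') \<in> \<theta>" for f
  proof (rule UN_equiv_class2[OF e e _ assms(2,3)])
    show "congruent2 \<theta> \<theta> (\<lambda>a b. \<theta> `` {f a b})"
      by (auto simp: congruent2_def intro!: equiv_class_eq[OF e] f)
  qed
  show "hmeet (hquot H \<theta>) (\<theta> `` {a}) (\<theta> `` {b}) = \<theta> `` {hmeet H a b}"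
    "hjoin (hquot H \<theta>) (\<theta> `` {a}) (\<theta> `` {b}) = \<theta> `` {hjoin H a b}"
    "himp (hquot H \<theta>) (\<theta> `` {a}) (\<theta> `` {b}) = \<theta> `` {himp H a b}"
    using assms(1) by (simp_all add: hquot_def hcong_def *)
qed

lemma hquot_heyting_algebra_iff:
  assumes H: "hclosed H" and c: "hcong H \<theta>"
  shows "heyting_algebra (hquot H \<theta>) \<longleftrightarrow>
    (\<forall>a\<in>hcarrier H. \<forall>b\<in>hcarrier H. \<forall>c\<in>hcarrier H.
        (hmeet H a b, hmeet H b a) \<in> \<theta> \<and> (hjoin H a b, hjoin H b a) \<in> \<theta> \<and>
        (hmeet H a (hmeet H b c), hmeet H (hmeet H a b) c) \<in> \<theta> \<and>
        (hjoin H a (hjoin H b c), hjoin H (hjoin H a b) c) \<in> \<theta> \<and>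
        (hmeet H a (hjoin H a b), a) \<in> \<theta> \<and> (hjoin H a (hmeet H a b), a) \<in> \<theta> \<and>
        (hmeet H a (htop H), a) \<in> \<theta> \<and> (hjoin H a (hbot H), a) \<in> \<theta> \<and>
        ((hmeet H (hmeet H c a) b, hmeet H c a) \<in> \<theta> \<longleftrightarrow> (hmeet H c (himp H a b), c) \<in> \<theta>))"
proof -
  have car: "hcarrier (hquot H \<theta>) = (\<lambda>a. \<theta> `` {a}) ` hcarrier H"
    and bt: "hbot (hquot H \<theta>) = \<theta> `` {hbot H}" "htop (hquot H \<theta>) = \<theta> `` {htop H}"
    by (auto simp: hquot_def quotient_def)
  have "hclosed (hquot H \<theta>)"
    using H by (auto simp: hclosed_def car bt hquot_ops[OF c])
  then show ?thesis
    using H unfolding heyting_algebra_def hle_def car bt ball_simps hclosed_def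
    by (simp add: hquot_ops[OF c] bt hcong_class_eq_iff[OF c] cong: ball_cong)
qed

lemma hclosed_term_algebra: "hclosed (term_algebra S)"
  by (auto simp: hclosed_def term_algebra_def)

lemma hcong_Inter:
  assumes "T \<noteq> {}" "\<And>\<theta>. \<theta> \<in> T \<Longrightarrow> hcong H \<theta>"
  shows "hcong H (\<Inter>T)"
proof -
  have "equiv (hcarrier H) (\<Inter>T)"
  proof (rule equivI)
    show "\<Inter>T \<subseteq> hcarrier H \<times> hcarrier H"
      using assms by (fastforce simp: hcong_def equiv_def)
    show "refl_on (hcarrier H) (\<Inter>T)"
      using assms by (auto simp: hcong_def equiv_def refl_on_def)
    show "sym (\<Inter>T)"
      using assms by (intro symI) (auto simp: hcong_def equiv_def, meson symD)
    show "trans (\<Inter>T)"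
      using assms by (intro transI) (auto simp: hcong_def equiv_def, meson transD)
  qed
  then show ?thesis using assms unfolding hcong_def by fast
qed

lemma hcong_total:
  assumes "hclosed H" shows "hcong H (hcarrier H \<times> hcarrier H)"
  using assms by (auto simp: hcong_def hclosed_def equiv_def refl_on_def sym_def trans_def)

lemma hcong_hcong_gen:
  assumes "hclosed H" "E \<subseteq> hcarrier H \<times> hcarrier H"
  shows "hcong H (hcong_gen H E)" "E \<subseteq> hcong_gen H E"
    "\<And>\<theta>. hcong H \<theta> \<Longrightarrow> E \<subseteq> \<theta> \<Longrightarrow> hcong_gen H E \<subseteq> \<theta>"
  using hcong_total[OF assms(1)] assms(2) unfolding hcong_gen_def
  by (intro hcong_Inter; auto) auto

lemma heyting_cong_hcong: "hcong (term_algebra S) (heyting_cong S)"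
  and free_heyting_heyting_algebra: "heyting_algebra (free_heyting S)"
proof -
  let ?A = "term_algebra S"
  let ?T = "{\<theta>. hcong ?A \<theta> \<and> heyting_algebra (hquot ?A \<theta>)}"
  note cl = hclosed_term_algebra[of S]
  have "heyting_algebra (hquot ?A (hcarrier ?A \<times> hcarrier ?A))"
    using cl by (simp add: hquot_heyting_algebra_iff[OF cl hcong_total[OF cl]]) (simp add: hclosed_def)
  then have ne: "?T \<noteq> {}" using hcong_total[OF cl] by blast
  show c: "hcong ?A (heyting_cong S)"
    unfolding heyting_cong_def using ne by (rule hcong_Inter) simp
  have mem: "(a, b) \<in> heyting_cong S \<longleftrightarrow> (\<forall>\<theta>\<in>?T. (a, b) \<in> \<theta>)" for a b
    by (auto simp: heyting_cong_def)
  have all: "\<theta> \<in> ?T \<Longrightarrow> hcong ?A \<theta> \<and> heyting_algebra (hquot ?A \<theta>)" for \<theta> by simp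
  show "heyting_algebra (free_heyting S)"
    unfolding free_heyting_def hquot_heyting_algebra_iff[OF cl c] mem
    using all by (auto simp: hquot_heyting_algebra_iff[OF cl])
qed

primrec heval :: "'a heyting \<Rightarrow> ('v \<Rightarrow> 'a) \<Rightarrow> 'v hterm \<Rightarrow> 'a" where
  "heval H f (Var v) = f v"
| "heval H f Bot = hbot H"
| "heval H f Top = htop H"
| "heval H f (Meet s t) = hmeet H (heval H f s) (heval H f t)"
| "heval H f (Join s t) = hjoin H (heval H f s) (heval H f t)"
| "heval H f (Imp s t) = himp H (heval H f s) (heval H f t)"

lemma free_heyting_universal:
  assumes H: "heyting_algebra H" and f: "f \<in> S \<rightarrow> hcarrier H"
  shows "\<exists>h. hhom (free_heyting S) H h \<and> (\<forall>v\<in>S. h (free_gen S v) = f v)"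
    and "hhom (free_heyting S) H h \<Longrightarrow> hhom (free_heyting S) H h' \<Longrightarrow>
      (\<And>v. v \<in> S \<Longrightarrow> h (free_gen S v) = h' (free_gen S v)) \<Longrightarrow>
      x \<in> hcarrier (free_heyting S) \<Longrightarrow> h x = h' x"
proof -
  let ?A = "term_algebra S"
  let ?\<theta> = "heyting_cong S"
  note cl = hclosed_term_algebra[of S] and c = heyting_cong_hcong[of S]
  have Hcl: "hclosed H" using H by (simp add: heyting_algebra_def)
  have car: "hcarrier (free_heyting S) = (\<lambda>a. ?\<theta> `` {a}) ` hcarrier ?A"
    and bt: "hbot (free_heyting S) = ?\<theta> `` {Bot}" "htop (free_heyting S) = ?\<theta> `` {Top}"
    by (auto simp: free_heyting_def hquot_def quotient_def term_algebra_def)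
  have ops: "hmeet (free_heyting S) (?\<theta> `` {a}) (?\<theta> `` {b}) = ?\<theta> `` {Meet a b}"
    "hjoin (free_heyting S) (?\<theta> `` {a}) (?\<theta> `` {b}) = ?\<theta> `` {Join a b}"
    "himp (free_heyting S) (?\<theta> `` {a}) (?\<theta> `` {b}) = ?\<theta> `` {Imp a b}"
    if "a \<in> hcarrier ?A" "b \<in> hcarrier ?A" for a b
    using hquot_ops[OF c that] by (simp_all add: free_heyting_def term_algebra_def)
  let ?e = "heval H f"
  have ev: "?e t \<in> hcarrier H" if "t \<in> hcarrier ?A" for t
    using that f Hcl by (induction t) (auto simp: term_algebra_def hclosed_def)
  define K where "K = {(s, t). s \<in> hcarrier ?A \<and> t \<in> hcarrier ?A \<and> ?e s = ?e t}"
  have Kc: "hcong ?A K"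
    by (auto simp: hcong_def equiv_def refl_on_def sym_def trans_def K_def term_algebra_def)
  have evs: "?e (hmeet ?A s t) = hmeet H (?e s) (?e t)" "?e (hjoin ?A s t) = hjoin H (?e s) (?e t)"
    "?e (himp ?A s t) = himp H (?e s) (?e t)" "?e (hbot ?A) = hbot H" "?e (htop ?A) = htop H" for s t
    by (simp_all add: term_algebra_def)
  have "heyting_algebra (hquot ?A K)"
    unfolding hquot_heyting_algebra_iff[OF cl Kc]
  proof (intro ballI)
    fix a b c assume m: "a \<in> hcarrier ?A" "b \<in> hcarrier ?A" "c \<in> hcarrier ?A"
    have *: "(s, t) \<in> K \<longleftrightarrow> ?e s = ?e t" if "s \<in> hcarrier ?A" "t \<in> hcarrier ?A" for s t
      using that by (simp add: K_def)
    have cl': "hmeet ?A s t \<in> hcarrier ?A" "hjoin ?A s t \<in> hcarrier ?A" "himp ?A s t \<in> hcarrier ?A"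
      if "s \<in> hcarrier ?A" "t \<in> hcarrier ?A" for s t
      using cl that by (auto simp: hclosed_def)
    have bt': "hbot ?A \<in> hcarrier ?A" "htop ?A \<in> hcarrier ?A"
      using cl by (auto simp: hclosed_def)
    show "(hmeet ?A a b, hmeet ?A b a) \<in> K \<and> (hjoin ?A a b, hjoin ?A b a) \<in> K \<and>
        (hmeet ?A a (hmeet ?A b c), hmeet ?A (hmeet ?A a b) c) \<in> K \<and>
        (hjoin ?A a (hjoin ?A b c), hjoin ?A (hjoin ?A a b) c) \<in> K \<and>
        (hmeet ?A a (hjoin ?A a b), a) \<in> K \<and> (hjoin ?A a (hmeet ?A a b), a) \<in> K \<and>
        (hmeet ?A a (htop ?A), a) \<in> K \<and> (hjoin ?A a (hbot ?A), a) \<in> K \<and>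
        ((hmeet ?A (hmeet ?A c a) b, hmeet ?A c a) \<in> K \<longleftrightarrow> (hmeet ?A c (himp ?A a b), c) \<in> K)"
      by (simp only: * cl' bt' m evs)
        (rule H[unfolded heyting_algebra_def hle_def, THEN conjunct2, rule_format,
          OF ev[OF m(1)] ev[OF m(2)] ev[OF m(3)]])
  qed
  then have sub: "?\<theta> \<subseteq> K" using Kc by (auto simp: heyting_cong_def)
  define h where "h A = ?e (SOME a. a \<in> A)" for A
  have h: "h (?\<theta> `` {a}) = ?e a" if "a \<in> hcarrier ?A" for a
  proof -
    have "a \<in> ?\<theta> `` {a}" using that c by (auto simp: hcong_def equiv_def refl_on_def)
    then have "(SOME b. b \<in> ?\<theta> `` {a}) \<in> ?\<theta> `` {a}" by (rule someI)
    then show ?thesis using sub by (auto simp: h_def K_def)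
  qed
  have mem: "Bot \<in> hcarrier ?A" "Top \<in> hcarrier ?A"
    "\<And>s t. s \<in> hcarrier ?A \<Longrightarrow> t \<in> hcarrier ?A \<Longrightarrow>
      Meet s t \<in> hcarrier ?A \<and> Join s t \<in> hcarrier ?A \<and> Imp s t \<in> hcarrier ?A"
    "\<And>v. v \<in> S \<Longrightarrow> Var v \<in> hcarrier ?A"
    by (auto simp: term_algebra_def)
  have "hhom (free_heyting S) H h"
    using ev mem by (auto simp: hhom_def car bt ops h)
  moreover have "\<forall>v\<in>S. h (free_gen S v) = f v"
    using mem by (simp add: free_gen_def h)
  ultimately show "\<exists>h. hhom (free_heyting S) H h \<and> (\<forall>v\<in>S. h (free_gen S v) = f v)" by blast
  show "h x = h' x"
    if hh: "hhom (free_heyting S) H h" "hhom (free_heyting S) H h'"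
      and g: "\<And>v. v \<in> S \<Longrightarrow> h (free_gen S v) = h' (free_gen S v)"
      and x: "x \<in> hcarrier (free_heyting S)" for h h' x
  proof -
    have "h (?\<theta> `` {t}) = h' (?\<theta> `` {t})" if "set_hterm t \<subseteq> S" for t
      using that
    proof (induction t)
      case (Var v) then show ?case using g by (simp add: free_gen_def)
    next
      case Bot then show ?case using hh by (simp add: hhom_def bt)
    next
      case Top then show ?case using hh by (simp add: hhom_def bt)
    next
      case (Meet s t)
      then have m: "s \<in> hcarrier ?A" "t \<in> hcarrier ?A" by (auto simp: term_algebra_def)
      show ?case unfolding ops(1)[OF m, symmetric] using Meet hh m by (auto simp: hhom_def car)
    next
      case (Join s t)
      then have m: "s \<in> hcarrier ?A" "t \<in> hcarrier ?A" by (auto simp: term_algebra_def)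
      show ?case unfolding ops(2)[OF m, symmetric] using Join hh m by (auto simp: hhom_def car)
    next
      case (Imp s t)
      then have m: "s \<in> hcarrier ?A" "t \<in> hcarrier ?A" by (auto simp: term_algebra_def)
      show ?case unfolding ops(3)[OF m, symmetric] using Imp hh m by (auto simp: hhom_def car)
    qed
    then show ?thesis using x by (auto simp: car term_algebra_def)
  qed
qed

end

theory Submission
  imports Defs
begin

text \<open>
  Layered bisimilarity in the style of Visser's semantic proof of uniform interpolation.
  Given \<open>x\<close> in an open set \<open>U\<close>, finitely many terms in the generators of \<open>X\<close> decide
  membership in \<open>U\<close>; let \<open>T\<close> consist of their subterms, those of the defining relations of
  \<open>X\<close>, and those of terms for the preimages of the generators of \<open>Y\<close>.
  If \<open>y\<close> is bisimilar to \<open>g x\<close> up to a depth bounded by the size of \<open>T\<close>, then amalgamating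
  the \<open>T\<close>-theories of points of \<open>X\<close> with points of \<open>Y\<close> yields a Kripke model that
  agrees with \<open>X\<close> on \<open>T\<close> and projects to \<open>Y\<close> by a p-morphism. It satisfies the relations of
  \<open>X\<close>, so the point over \<open>(x, y)\<close> induces a prime filter of clopen up-sets of \<open>X\<close>, that is,
  a point of \<open>U\<close> mapped to \<open>y\<close>. Since \<open>Y\<close> is finitely generated, the points bisimilar to
  \<open>g x\<close> up to a fixed depth contain a clopen neighbourhood of \<open>g x\<close>.
\<close>

section \<open>Terms and presentations\<close>

lemma heyting_algebra_hclosed: "heyting_algebra H \<Longrightarrow> hclosed H"
  by (simp add: heyting_algebra_def)

lemma heval_closed:
  assumes "hclosed H" "f \<in> S \<rightarrow> hcarrier H" "set_hterm t \<subseteq> S"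
  shows "heval H f t \<in> hcarrier H"
  using assms(3) by (induction t) (use assms(1,2) in \<open>auto simp: hclosed_def\<close>)

lemma hhom_heval:
  assumes h: "hhom H K h" and H: "hclosed H" and f: "f \<in> S \<rightarrow> hcarrier H"
    and t: "set_hterm t \<subseteq> S"
  shows "h (heval H f t) = heval K (h \<circ> f) t"
  using t h by (induction t) (auto simp: hhom_def heval_closed[OF H f])

lemma heval_cong:
  "(\<And>v. v \<in> set_hterm t \<Longrightarrow> f v = f' v) \<Longrightarrow> heval H f t = heval H f' t"
  by (induction t) auto

text \<open>A class of the free algebra is the value of its representing term at the free
  generators, and homomorphisms commute with evaluation.\<close>

lemma free_heyting_class_heval:
  assumes h: "hhom (free_heyting S) H h" and t: "set_hterm t \<subseteq> S"
  shows "h (heyting_cong S `` {t}) = heval H (\<lambda>v. h (free_gen S v)) t"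
proof -
  have cl: "hclosed (free_heyting S)"
    by (rule heyting_algebra_hclosed[OF free_heyting_heyting_algebra])
  have gen: "free_gen S \<in> S \<rightarrow> hcarrier (free_heyting S)"
    by (auto simp: free_gen_def free_heyting_def hquot_def term_algebra_def intro!: quotientI)
  have "heval (free_heyting S) (free_gen S) t = heyting_cong S `` {t}"
    using t
  proof (induction t)
    case (Meet a b)
    then show ?case using hquot_ops(1)[OF heyting_cong_hcong, of a S b]
      by (auto simp: free_heyting_def term_algebra_def)
  next
    case (Join a b)
    then show ?case using hquot_ops(2)[OF heyting_cong_hcong, of a S b]
      by (auto simp: free_heyting_def term_algebra_def)
  next
    case (Imp a b)
    then show ?case using hquot_ops(3)[OF heyting_cong_hcong, of a S b]
      by (auto simp: free_heyting_def term_algebra_def)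
  qed (auto simp: free_gen_def free_heyting_def hquot_def term_algebra_def)
  then show ?thesis
    using hhom_heval[OF h cl gen t] by (simp add: comp_def)
qed

section \<open>Kernels, quotients and finite presentations\<close>

lemma hhom_kernel_hcong:
  assumes H: "hclosed H" and h: "hhom H K h"
  shows "hcong H {(a, b). a \<in> hcarrier H \<and> b \<in> hcarrier H \<and> h a = h b}"
  using assms
  by (auto simp: hcong_def equiv_def refl_on_def sym_def trans_def hhom_def hclosed_def)

lemma hhom_quotient_map:
  assumes H: "hclosed H" and c: "hcong H \<theta>"
  shows "hhom H (hquot H \<theta>) (\<lambda>a. \<theta> `` {a})"
  using hquot_ops[OF c] by (auto simp: hhom_def hquot_def intro: quotientI)

text \<open>The form of finite presentation used below: generators, finitely many relations between
  terms, and von Dyck's property that an assignment satisfying \<open>R\<close> satisfies every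
  equation true in \<open>A\<close>. The type \<open>'c\<close> of the test algebras is left open,
  to be instantiated with the type of the amalgamated model.\<close>

lemma finitely_presentedE:
  fixes A :: "'a heyting"
  assumes fp: "finitely_presented A" and A: "hclosed A"
  obtains S :: "nat set" and f :: "nat \<Rightarrow> 'a" and R :: "nat hterm rel"
  where "finite S" and "f \<in> S \<rightarrow> hcarrier A"
    and "\<And>a. a \<in> hcarrier A \<Longrightarrow> \<exists>t. set_hterm t \<subseteq> S \<and> a = heval A f t"
    and "finite R"
    and "\<And>l u. (l, u) \<in> R \<Longrightarrow> set_hterm l \<subseteq> S \<and> set_hterm u \<subseteq> S \<and> heval A f l = heval A f u"
    and "\<And>(H :: 'c heyting) f' t u. heyting_algebra H \<Longrightarrow> f' \<in> S \<rightarrow> hcarrier H \<Longrightarrow>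
      (\<forall>(l, u)\<in>R. heval H f' l = heval H f' u) \<Longrightarrow>
      set_hterm t \<subseteq> S \<Longrightarrow> set_hterm u \<subseteq> S \<Longrightarrow> heval A f t = heval A f u \<Longrightarrow>
      heval H f' t = heval H f' u"
proof -
  from fp obtain S :: "nat set" and E \<phi> where S: "finite S" and E: "finite E"
    and EF: "E \<subseteq> hcarrier (free_heyting S) \<times> hcarrier (free_heyting S)"
    and \<phi>: "hhom A (hquot (free_heyting S) (hcong_gen (free_heyting S) E)) \<phi>"
      "bij_betw \<phi> (hcarrier A) (hcarrier (hquot (free_heyting S) (hcong_gen (free_heyting S) E)))"
    unfolding finitely_presented_def hisomorphic_def by blast
  let ?F = "free_heyting S"
  let ?\<theta> = "hcong_gen ?F E"
  let ?Q = "hquot ?F ?\<theta>"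
  let ?c = "\<lambda>t. heyting_cong S `` {t}"
  have Fcl: "hclosed ?F" by (rule heyting_algebra_hclosed[OF free_heyting_heyting_algebra])
  note cg = hcong_hcong_gen[OF Fcl EF]
  have carF: "hcarrier ?F = ?c ` {t. set_hterm t \<subseteq> S}"
    by (auto simp: free_heyting_def hquot_def quotient_def term_algebra_def)
  have carQ: "hcarrier ?Q = (\<lambda>a. ?\<theta> `` {a}) ` hcarrier ?F"
    by (auto simp: hquot_def quotient_def)
  have genF: "free_gen S v \<in> hcarrier ?F" if "v \<in> S" for v
    using that by (auto simp: carF free_gen_def)
  \<comment> \<open>The generators are pulled back along the isomorphism, so that
    \<open>\<phi>\<close> sends the value of a term to its class in the presented quotient.\<close>
  define f where "f v = inv_into (hcarrier A) \<phi> (?\<theta> `` {free_gen S v})" for v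
  have f: "f v \<in> hcarrier A" "\<phi> (f v) = ?\<theta> `` {free_gen S v}" if "v \<in> S" for v
  proof -
    have "?\<theta> `` {free_gen S v} \<in> \<phi> ` hcarrier A"
      using genF[OF that] \<phi>(2) by (auto simp: bij_betw_def carQ)
    then show "f v \<in> hcarrier A" "\<phi> (f v) = ?\<theta> `` {free_gen S v}"
      unfolding f_def by (rule inv_into_into, rule f_inv_into_f)
  qed
  have fS: "f \<in> S \<rightarrow> hcarrier A" using f by auto
  have \<phi>ev: "\<phi> (heval A f t) = ?\<theta> `` {?c t}" if t: "set_hterm t \<subseteq> S" for t
  proof -
    have "\<phi> (heval A f t) = heval ?Q (\<phi> \<circ> f) t"
      by (rule hhom_heval[OF \<phi>(1) A fS t])
    also have "\<dots> = heval ?Q (\<lambda>v. ?\<theta> `` {free_gen S v}) t"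
      using f t by (intro heval_cong) auto
    also have "\<dots> = ?\<theta> `` {?c t}"
      by (rule free_heyting_class_heval[OF hhom_quotient_map[OF Fcl cg(1)] t, symmetric])
    finally show ?thesis .
  qed
  have inj: "a = b" if "a \<in> hcarrier A" "b \<in> hcarrier A" "\<phi> a = \<phi> b" for a b
    using that \<phi>(2) by (auto simp: bij_betw_def inj_on_def)
  have ker: "heval A f t = heval A f u \<longleftrightarrow> (?c t, ?c u) \<in> ?\<theta>"
    if t: "set_hterm t \<subseteq> S" and u: "set_hterm u \<subseteq> S" for t u
  proof -
    have "heval A f t = heval A f u \<longleftrightarrow> ?\<theta> `` {?c t} = ?\<theta> `` {?c u}"
      using inj[OF heval_closed[OF A fS t] heval_closed[OF A fS u]]
      by (metis \<phi>ev t u)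
    also have "\<dots> \<longleftrightarrow> (?c t, ?c u) \<in> ?\<theta>"
      using hcong_class_eq_iff[OF cg(1)] t u by (auto simp: carF)
    finally show ?thesis .
  qed
  \<comment> \<open>\<open>E\<close> relates classes of the free algebra; representatives turn it
    into relations between terms, which can be evaluated in any algebra.\<close>
  define rep where "rep a = (SOME t. set_hterm t \<subseteq> S \<and> a = ?c t)" for a
  have rep: "set_hterm (rep a) \<subseteq> S" "?c (rep a) = a" if "a \<in> hcarrier ?F" for a
  proof -
    have "\<exists>t. set_hterm t \<subseteq> S \<and> a = ?c t" using that by (auto simp: carF)
    then have "set_hterm (rep a) \<subseteq> S \<and> a = ?c (rep a)"
      unfolding rep_def by (rule someI_ex)
    then show "set_hterm (rep a) \<subseteq> S" "?c (rep a) = a" by auto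
  qed
  define R where "R = (\<lambda>(a, b). (rep a, rep b)) ` E"
  show thesis
  proof (rule that[of S f R])
    show "finite S" by fact
    show "f \<in> S \<rightarrow> hcarrier A" by fact
    show "finite R" using E by (simp add: R_def)
    show "\<exists>t. set_hterm t \<subseteq> S \<and> a = heval A f t" if a: "a \<in> hcarrier A" for a
    proof -
      have "\<phi> a \<in> hcarrier ?Q" using a \<phi>(2) by (auto simp: bij_betw_def)
      then obtain t where t: "set_hterm t \<subseteq> S" "\<phi> a = ?\<theta> `` {?c t}"
        by (auto simp: carQ carF)
      then have "a = heval A f t"
        by (intro inj a heval_closed[OF A fS]) (simp_all add: \<phi>ev)
      with t show ?thesis by blast
    qed
    show "set_hterm l \<subseteq> S \<and> set_hterm u \<subseteq> S \<and> heval A f l = heval A f u"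
      if lu: "(l, u) \<in> R" for l u
    proof -
      obtain a b where ab: "(a, b) \<in> E" "l = rep a" "u = rep b"
        using lu by (auto simp: R_def)
      then have m: "a \<in> hcarrier ?F" "b \<in> hcarrier ?F" using EF by auto
      then show ?thesis
        using rep[OF m(1)] rep[OF m(2)] ab cg(2) by (auto simp: ker)
    qed
    show "heval H f' t = heval H f' u"
      if H: "heyting_algebra H" and f': "f' \<in> S \<rightarrow> hcarrier H"
        and R: "\<forall>(l, u)\<in>R. heval H f' l = heval H f' u"
        and t: "set_hterm t \<subseteq> S" and u: "set_hterm u \<subseteq> S" and eq: "heval A f t = heval A f u"
      for H :: "'c heyting" and f' t u
    proof -
      obtain h where h: "hhom ?F H h" and hv: "\<And>v. v \<in> S \<Longrightarrow> h (free_gen S v) = f' v"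
        using free_heyting_universal(1)[OF H f'] by blast
      have hc: "h (?c t) = heval H f' t" if "set_hterm t \<subseteq> S" for t
      proof -
        have "heval H (\<lambda>v. h (free_gen S v)) t = heval H f' t"
          using hv that by (intro heval_cong) auto
        then show ?thesis using free_heyting_class_heval[OF h that] by simp
      qed
      \<comment> \<open>The kernel of \<open>h\<close> is a congruence containing \<open>E\<close>,
        hence contains the congruence generated by \<open>E\<close>.\<close>
      have "E \<subseteq> {(a, b). a \<in> hcarrier ?F \<and> b \<in> hcarrier ?F \<and> h a = h b}"
      proof (clarify, intro conjI)
        fix a b assume ab: "(a, b) \<in> E"
        then show m: "a \<in> hcarrier ?F" "b \<in> hcarrier ?F" using EF by auto
        have "heval H f' (rep a) = heval H f' (rep b)"
          using ab R by (force simp: R_def)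
        then show "h a = h b"
          using hc[OF rep(1)[OF m(1)]] hc[OF rep(1)[OF m(2)]] rep(2)[OF m(1)] rep(2)[OF m(2)]
          by simp
      qed
      then have "?\<theta> \<subseteq> {(a, b). a \<in> hcarrier ?F \<and> b \<in> hcarrier ?F \<and> h a = h b}"
        by (rule cg(3)[OF hhom_kernel_hcong[OF Fcl h]])
      then show ?thesis using ker[OF t u] eq hc[OF t] hc[OF u] by auto
    qed
  qed
qed

section \<open>Subterms\<close>

primrec subterms :: "'v hterm \<Rightarrow> 'v hterm set" where
  "subterms (Var v) = {Var v}"
| "subterms Bot = {Bot}"
| "subterms Top = {Top}"
| "subterms (Meet t u) = insert (Meet t u) (subterms t \<union> subterms u)"
| "subterms (Join t u) = insert (Join t u) (subterms t \<union> subterms u)"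
| "subterms (Imp t u) = insert (Imp t u) (subterms t \<union> subterms u)"

lemma subterms_refl [simp]: "t \<in> subterms t"
  by (cases t) auto

lemma subterms_trans: "u \<in> subterms t \<Longrightarrow> subterms u \<subseteq> subterms t"
  by (induction t) auto

lemma finite_subterms [simp]: "finite (subterms t)"
  by (induction t) auto

lemma set_hterm_subterms: "u \<in> subterms t \<Longrightarrow> set_hterm u \<subseteq> set_hterm t"
  by (induction t) auto


section \<open>Upset algebras\<close>

lemma upset_algebra_simps [simp]:
  "hcarrier (upset_algebra X r) = {U. clopen_upset X r U}"
  "hbot (upset_algebra X r) = {}"
  "htop (upset_algebra X r) = topspace X"
  "hmeet (upset_algebra X r) = (\<inter>)"
  "hjoin (upset_algebra X r) = (\<union>)"
  "himp (upset_algebra X r) U V = topspace X - down r (U - V)"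
  by (simp_all add: upset_algebra_def)

text \<open>In the discrete topology every subset is clopen, so \<open>upset_algebra\<close> is here
  the algebra of all up-sets of a Kripke frame. The amalgamated model is treated in this
  way.\<close>

lemma heyting_algebra_discrete:
  assumes "r \<subseteq> Z \<times> Z" "refl_on Z r" "trans r"
  shows "heyting_algebra (upset_algebra (discrete_topology Z) r)"
proof -
  have cu: "clopen_upset (discrete_topology Z) r U \<longleftrightarrow> U \<subseteq> Z \<and> up r U \<subseteq> U" for U
    by (auto simp: clopen_upset_def clopenin_def)
  have imp: "Z - down r (U - V) \<subseteq> Z \<and> up r (Z - down r (U - V)) \<subseteq> Z - down r (U - V)" for U V
  proof (intro conjI subsetI)
    fix y assume "y \<in> up r (Z - down r (U - V))"
    then obtain x where x: "x \<notin> down r (U - V)" "(x, y) \<in> r" by auto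
    then have "y \<notin> down r (U - V)" using transD[OF assms(3) x(2)] by blast
    then show "y \<in> Z - down r (U - V)" using x assms(1) by auto
  qed auto
  have res: "W \<inter> U \<subseteq> V \<longleftrightarrow> W \<subseteq> Z - down r (U - V)"
    if "U \<subseteq> Z" "W \<subseteq> Z" "up r W \<subseteq> W" for U V W
  proof
    assume "W \<inter> U \<subseteq> V" then show "W \<subseteq> Z - down r (U - V)" using that by auto
  next
    assume "W \<subseteq> Z - down r (U - V)" then show "W \<inter> U \<subseteq> V"
      using that assms(2) unfolding refl_on_def by blast
  qed
  have le: "hle (upset_algebra (discrete_topology Z) r) U V \<longleftrightarrow> U \<subseteq> V" for U V
    by (auto simp: hle_def)
  have "hclosed (upset_algebra (discrete_topology Z) r)"
    unfolding hclosed_def using imp assms(1) by (auto simp: cu)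
  then show ?thesis
    unfolding heyting_algebra_def le using res by (simp add: cu) blast
qed

section \<open>Points and open sets of Esakia spaces\<close>

lemma esakia_spaceD:
  assumes "esakia_space X r"
  shows "compact_space X" "r \<subseteq> topspace X \<times> topspace X"
    "\<And>x. x \<in> topspace X \<Longrightarrow> (x, x) \<in> r" "trans r" "antisym r"
    "\<And>C. clopenin X C \<Longrightarrow> clopenin X (down r C)"
  using assms
  by (auto simp: esakia_space_def partial_order_on_def preorder_on_def refl_on_def)

text \<open>Antisymmetry makes one of the two order relations fail, but not a particular one; hence
  the symmetric form of the conclusion.\<close>

lemma esakia_space_separation:
  assumes X: "esakia_space X r" and x: "x \<in> topspace X" and y: "y \<in> topspace X" and "x \<noteq> y"
  obtains U where "clopen_upset X r U" "x \<in> U \<longleftrightarrow> y \<notin> U"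
proof -
  have "(x, y) \<notin> r \<or> (y, x) \<notin> r"
    using esakia_spaceD(5)[OF X] \<open>x \<noteq> y\<close> by (auto simp: antisym_def)
  then show thesis
    using X x y that unfolding esakia_space_def by metis
qed

lemma clopenin_diff:
  "clopenin X U \<Longrightarrow> clopenin X V \<Longrightarrow> clopenin X (U - V)"
  by (auto simp: clopenin_def)

text \<open>Compactness applied to the members of \<open>P\<close> together with the complements of
  the clopen up-sets outside \<open>P\<close>.\<close>

lemma prime_filter_point:
  assumes X: "esakia_space X r"
    and P: "\<And>U. U \<in> P \<Longrightarrow> clopen_upset X r U"
    and top: "topspace X \<in> P" and bot: "{} \<notin> P"
    and meet: "\<And>U V. U \<in> P \<Longrightarrow> V \<in> P \<Longrightarrow> U \<inter> V \<in> P"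
    and mono: "\<And>U V. U \<in> P \<Longrightarrow> clopen_upset X r V \<Longrightarrow> U \<subseteq> V \<Longrightarrow> V \<in> P"
    and prime: "\<And>U V. clopen_upset X r U \<Longrightarrow> clopen_upset X r V \<Longrightarrow>
      U \<union> V \<in> P \<Longrightarrow> U \<in> P \<or> V \<in> P"
  obtains x where "x \<in> topspace X" "\<And>U. clopen_upset X r U \<Longrightarrow> x \<in> U \<longleftrightarrow> U \<in> P"
proof -
  define N where "N = {U. clopen_upset X r U \<and> U \<notin> P}"
  define \<U> where "\<U> = P \<union> (\<lambda>U. topspace X - U) ` N"
  have emp: "{} \<in> N" using bot by (simp add: N_def clopen_upset_def clopenin_def)
  have un: "U \<union> V \<in> N" if "U \<in> N" "V \<in> N" for U V
    using that prime[of U V] by (auto simp: N_def clopen_upset_def clopenin_def)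
  have fip: "\<Inter>\<F> \<noteq> {}" if "finite \<F>" "\<F> \<subseteq> \<U>" for \<F>
  proof -
    \<comment> \<open>\<open>P\<close> is closed under intersections and, by primeness,
      \<open>N\<close> under unions, so a finite intersection contains a single difference
      \<open>U - V\<close>; this is nonempty because \<open>P\<close> is upward closed.\<close>
    have "\<exists>U\<in>P. \<exists>V\<in>N. U - V \<subseteq> \<Inter>\<F>"
      using that
    proof (induction \<F>)
      case empty
      then show ?case using top emp by auto
    next
      case (insert C \<F>)
      then obtain U V where UV: "U \<in> P" "V \<in> N" "U - V \<subseteq> \<Inter>\<F>" by auto
      from insert.prems have "C \<in> P \<or> (\<exists>W\<in>N. C = topspace X - W)" by (auto simp: \<U>_def)
      then show ?case
      proof
        assume "C \<in> P"
        moreover have "(U \<inter> C) - V \<subseteq> \<Inter>(insert C \<F>)" using UV(3) by auto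
        ultimately show ?thesis using meet[OF UV(1)] UV(2) by (intro bexI)
      next
        assume "\<exists>W\<in>N. C = topspace X - W"
        then obtain W where W: "W \<in> N" "C = topspace X - W" by blast
        have "U \<subseteq> topspace X"
          using P[OF UV(1)] by (auto simp: clopen_upset_def clopenin_def dest: openin_subset)
        then have "U - (V \<union> W) \<subseteq> \<Inter>(insert C \<F>)" using UV W by auto
        then show ?thesis using UV(1) un[OF UV(2) W(1)] by (intro bexI)
      qed
    qed
    then obtain U V where "U \<in> P" "V \<in> N" "U - V \<subseteq> \<Inter>\<F>" by blast
    moreover have "\<not> U \<subseteq> V" using mono \<open>U \<in> P\<close> \<open>V \<in> N\<close> by (auto simp: N_def)
    ultimately show ?thesis by blast
  qed
  have "closedin X C" if "C \<in> \<U>" for C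
    using that P by (auto simp: \<U>_def N_def clopen_upset_def clopenin_def)
  then have "\<Inter>\<U> \<noteq> {}"
    using esakia_spaceD(1)[OF X] fip unfolding compact_space_fip by blast
  then obtain x where x: "\<And>C. C \<in> \<U> \<Longrightarrow> x \<in> C" by auto
  have "x \<in> U \<longleftrightarrow> U \<in> P" if "clopen_upset X r U" for U
  proof (cases "U \<in> P")
    case True then show ?thesis using x by (simp add: \<U>_def)
  next
    case False
    then have "topspace X - U \<in> \<U>" using that by (auto simp: \<U>_def N_def)
    then show ?thesis using x False by blast
  qed
  moreover have "x \<in> topspace X" using x top by (simp add: \<U>_def)
  ultimately show thesis using that by blast
qed

text \<open>The sets \<open>D W\<close> of points that \<open>W\<close> separates from
  \<open>x\<close> form an open cover of the compact complement of \<open>U\<close>; a finite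
  subcover yields \<open>\<W>\<close>.\<close>

lemma openin_determined_by_upsets:
  assumes X: "esakia_space X r" and U: "openin X U" and x: "x \<in> U"
  obtains \<W> where "finite \<W>" "\<And>W. W \<in> \<W> \<Longrightarrow> clopen_upset X r W"
    "\<And>y. y \<in> topspace X \<Longrightarrow> (\<forall>W\<in>\<W>. x \<in> W \<longleftrightarrow> y \<in> W) \<Longrightarrow> y \<in> U"
proof -
  have xX: "x \<in> topspace X" using U x openin_subset by blast
  define D where "D W = {y \<in> topspace X. x \<in> W \<longleftrightarrow> y \<notin> W}" for W
  have D: "openin X (D W)" if "clopen_upset X r W" for W
  proof -
    have W: "openin X W" "openin X (topspace X - W)"
      using that by (auto simp: clopen_upset_def clopenin_def)
    have "D W = (if x \<in> W then topspace X - W else W)"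
      using openin_subset[OF W(1)] by (auto simp: D_def)
    then show ?thesis using W by simp
  qed
  have comp: "compactin X (topspace X - U)"
    by (rule closedin_compact_space[OF esakia_spaceD(1)[OF X] closedin_diff[OF closedin_topspace U]])
  have cover: "topspace X - U \<subseteq> \<Union>(D ` {W. clopen_upset X r W})"
  proof
    fix y assume y: "y \<in> topspace X - U"
    then have "x \<noteq> y" using x by auto
    then obtain W where "clopen_upset X r W" "x \<in> W \<longleftrightarrow> y \<notin> W"
      using esakia_space_separation[OF X xX] y by blast
    then show "y \<in> \<Union>(D ` {W. clopen_upset X r W})" using y by (auto simp: D_def)
  qed
  have op: "openin X V" if "V \<in> D ` {W. clopen_upset X r W}" for V
    using that D by auto
  from compactinD[OF comp op cover]
  obtain \<F> where \<F>: "finite \<F>" "\<F> \<subseteq> D ` {W. clopen_upset X r W}" "topspace X - U \<subseteq> \<Union>\<F>"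
    by blast
  from finite_subset_image[OF \<F>(1,2)]
  obtain \<W> where \<W>: "finite \<W>" "\<W> \<subseteq> {W. clopen_upset X r W}" "\<F> = D ` \<W>"
    by auto
  show thesis
  proof (rule that[OF \<W>(1)])
    show "clopen_upset X r W" if "W \<in> \<W>" for W using that \<W> by auto
    show "y \<in> U" if "y \<in> topspace X" "\<forall>W\<in>\<W>. x \<in> W \<longleftrightarrow> y \<in> W" for y
      using that \<F>(3) \<W>(3) by (auto simp: D_def)
  qed
qed

section \<open>Monotonicity and lifting for p-morphisms\<close>

lemma p_morphism_mono:
  assumes g: "p_morphism X r Y s g" and r: "r \<subseteq> topspace X \<times> topspace X" and xx: "(x, x') \<in> r"
  shows "(g x, g x') \<in> s"
proof -
  \<comment> \<open>One inclusion of the p-morphism equation at a singleton gives monotonicity; the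
    other gives the lifting in the next lemma.\<close>
  have "{g x'} \<subseteq> topspace Y" using g r xx by (auto simp: p_morphism_def)
  then have "down r (g -` {g x'} \<inter> topspace X) = g -` (down s {g x'}) \<inter> topspace X"
    using g unfolding p_morphism_def by blast
  moreover have "x \<in> down r (g -` {g x'} \<inter> topspace X)" using r xx by auto
  ultimately show ?thesis by auto
qed

lemma p_morphism_lift:
  assumes g: "p_morphism X r Y s g" and "x \<in> topspace X" "y \<in> topspace Y" "(g x, y) \<in> s"
  obtains x' where "(x, x') \<in> r" "g x' = y"
proof -
  have "down r (g -` {y} \<inter> topspace X) = g -` (down s {y}) \<inter> topspace X"
    using g assms(3) unfolding p_morphism_def by blast
  moreover have "x \<in> g -` (down s {y}) \<inter> topspace X" using assms by auto
  ultimately show thesis using that by auto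
qed


section \<open>Layered bisimilarity\<close>

text \<open>Back-and-forth equivalence of \<open>n\<close> rounds, with membership in the members of
  \<open>Q\<close> as the atomic condition. The conjunct \<open>layer s Q n y y'\<close> makes the
  relations decrease in \<open>n\<close>.\<close>

primrec layer :: "'b rel \<Rightarrow> 'b set set \<Rightarrow> nat \<Rightarrow> 'b \<Rightarrow> 'b \<Rightarrow> bool" where
  "layer s Q 0 y y' \<longleftrightarrow> (\<forall>W\<in>Q. y \<in> W \<longleftrightarrow> y' \<in> W)"
| "layer s Q (Suc n) y y' \<longleftrightarrow> layer s Q n y y' \<and>
     (\<forall>z. (y, z) \<in> s \<longrightarrow> (\<exists>z'. (y', z') \<in> s \<and> layer s Q n z z')) \<and>
     (\<forall>z'. (y', z') \<in> s \<longrightarrow> (\<exists>z. (y, z) \<in> s \<and> layer s Q n z z'))"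

lemma layer_antimono: "m \<le> n \<Longrightarrow> layer s Q n y y' \<Longrightarrow> layer s Q m y y'"
  by (induction n) (auto simp: le_Suc_eq)

lemma layer_zero: "layer s Q n y y' \<Longrightarrow> W \<in> Q \<Longrightarrow> y \<in> W \<longleftrightarrow> y' \<in> W"
  using layer_antimono[of 0 n s Q y y'] by simp

section \<open>Clopen conditions that determine layers\<close>

lemma clopenin_atom:
  assumes "finite F" "\<forall>W\<in>F. clopenin Y W"
  shows "clopenin Y {y \<in> topspace Y. \<forall>W\<in>F. y \<in> W \<longleftrightarrow> W \<in> G}"
  using assms
proof (induction F)
  case empty
  then show ?case by (simp add: clopenin_def)
next
  case (insert V F)
  let ?A = "{y \<in> topspace Y. \<forall>W\<in>F. y \<in> W \<longleftrightarrow> W \<in> G}"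
  have "{y \<in> topspace Y. \<forall>W\<in>insert V F. y \<in> W \<longleftrightarrow> W \<in> G} = (if V \<in> G then ?A - (?A - V) else ?A - V)"
    by auto
  then show ?case using insert by (simp add: clopenin_diff)
qed

text \<open>By induction, layer \<open>n\<close> depends only on the cell of a point in a finite
  clopen partition. The next layer also asks which cells can be reached from the point, which is
  membership in the down-sets of cells; these are clopen in an Esakia space.\<close>

lemma layer_determined_by_clopens:
  assumes Y: "esakia_space Y s" and Q: "finite Q" "\<forall>W\<in>Q. clopenin Y W"
  shows "\<exists>F. finite F \<and> (\<forall>W\<in>F. clopenin Y W) \<and>
    (\<forall>y\<in>topspace Y. \<forall>y'\<in>topspace Y. (\<forall>W\<in>F. y \<in> W \<longleftrightarrow> y' \<in> W) \<longrightarrow> layer s Q n y y')"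
proof (induction n)
  case 0
  then show ?case using Q by (intro exI[of _ Q]) auto
next
  case (Suc n)
  then obtain F where F: "finite F" "\<forall>W\<in>F. clopenin Y W"
    "\<And>y y'. y \<in> topspace Y \<Longrightarrow> y' \<in> topspace Y \<Longrightarrow> (\<forall>W\<in>F. y \<in> W \<longleftrightarrow> y' \<in> W) \<Longrightarrow> layer s Q n y y'"
    by blast
  define atom where "atom G = {y \<in> topspace Y. \<forall>W\<in>F. y \<in> W \<longleftrightarrow> W \<in> G}" for G
  define F' where "F' = F \<union> (\<lambda>G. down s (atom G)) ` Pow F"
  have atom: "z \<in> atom {W \<in> F. z \<in> W}" if "z \<in> topspace Y" for z
    using that by (auto simp: atom_def)
  have down: "\<exists>z'. (y', z') \<in> s \<and> z' \<in> topspace Y \<and> (\<forall>W\<in>F. z \<in> W \<longleftrightarrow> z' \<in> W)"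
    if y: "\<forall>W\<in>F'. y \<in> W \<longleftrightarrow> y' \<in> W" and z: "(y, z) \<in> s" for y y' z
  proof -
    have zY: "z \<in> topspace Y" using z esakia_spaceD(2)[OF Y] by auto
    let ?G = "{W \<in> F. z \<in> W}"
    have "down s (atom ?G) \<in> F'" by (auto simp: F'_def)
    moreover have "y \<in> down s (atom ?G)" using z atom[OF zY] by auto
    ultimately have "y' \<in> down s (atom ?G)" using y by blast
    then show ?thesis by (auto simp: atom_def)
  qed
  have "layer s Q (Suc n) y y'"
    if y: "y \<in> topspace Y" "y' \<in> topspace Y" "\<forall>W\<in>F'. y \<in> W \<longleftrightarrow> y' \<in> W" for y y'
  proof -
    have "layer s Q n y y'" using y F(3) by (auto simp: F'_def)
    moreover have "\<exists>z'. (y', z') \<in> s \<and> layer s Q n z z'" if z: "(y, z) \<in> s" for z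
      using down[OF y(3) z] F(3)[of z] z esakia_spaceD(2)[OF Y] by auto
    moreover have "\<exists>z. (y, z) \<in> s \<and> layer s Q n z z'" if z: "(y', z') \<in> s" for z'
    proof -
      have "\<forall>W\<in>F'. y' \<in> W \<longleftrightarrow> y \<in> W" using y(3) by blast
      from down[OF this z] obtain w
        where w: "(y, w) \<in> s" "w \<in> topspace Y" "\<forall>W\<in>F. z' \<in> W \<longleftrightarrow> w \<in> W" by blast
      have "z' \<in> topspace Y" using z esakia_spaceD(2)[OF Y] by blast
      then have "layer s Q n w z'" by (rule F(3)[OF w(2)]) (simp add: w(3))
      with w(1) show ?thesis by blast
    qed
    ultimately show ?thesis by simp
  qed
  moreover have "finite F'" using F(1) by (simp add: F'_def)
  moreover have "\<forall>W\<in>F'. clopenin Y W"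
  proof -
    have "clopenin Y (atom G)" for G unfolding atom_def by (rule clopenin_atom[OF F(1,2)])
    then show ?thesis unfolding F'_def using F(2) esakia_spaceD(6)[OF Y] by blast
  qed
  ultimately show ?case by blast
qed

lemma layer_neighbourhood:
  assumes Y: "esakia_space Y s" and Q: "finite Q" "\<forall>W\<in>Q. clopenin Y W"
    and y: "y \<in> topspace Y"
  obtains V where "openin Y V" "y \<in> V" "\<And>y'. y' \<in> V \<Longrightarrow> layer s Q n y y'"
proof -
  from layer_determined_by_clopens[OF Y Q, of n]
  obtain F where F: "finite F" "\<forall>W\<in>F. clopenin Y W"
    "\<forall>y\<in>topspace Y. \<forall>y'\<in>topspace Y. (\<forall>W\<in>F. y \<in> W \<longleftrightarrow> y' \<in> W) \<longrightarrow> layer s Q n y y'"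
    by (elim exE conjE)
  let ?V = "{y' \<in> topspace Y. \<forall>W\<in>F. y' \<in> W \<longleftrightarrow> W \<in> {W. y \<in> W}}"
  show thesis
  proof (rule that[of ?V])
    have "clopenin Y ?V" by (rule clopenin_atom[OF F(1,2)])
    then show "openin Y ?V" by (simp add: clopenin_def)
  qed (use y F(3) in auto)
qed


section \<open>Amalgamation\<close>

text \<open>The data of one amalgamation: \<open>T\<close> is the finite set of terms, closed under
  subterms, on which the model is to agree with \<open>X\<close>, and \<open>Q\<close> supplies the
  atomic conditions on \<open>Y\<close>.\<close>

locale amalgam =
  fixes X :: "'a topology" and r :: "'a rel" and Y :: "'b topology" and s :: "'b rel"
    and g :: "'a \<Rightarrow> 'b" and S :: "'v set" and f :: "'v \<Rightarrow> 'a set"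
    and T :: "'v hterm set" and Q :: "'b set set"
  assumes X: "esakia_space X r" and Y: "esakia_space Y s" and g: "p_morphism X r Y s g"
    and f: "f \<in> S \<rightarrow> hcarrier (upset_algebra X r)"
    and finite_T: "finite T"
    and T_subterms: "\<And>t. t \<in> T \<Longrightarrow> subterms t \<subseteq> T"
    and T_S: "\<And>t. t \<in> T \<Longrightarrow> set_hterm t \<subseteq> S"
begin

section \<open>Theories of points and the model\<close>

abbreviation val :: "'v hterm \<Rightarrow> 'a set" where
  "val \<equiv> heval (upset_algebra X r) f"

lemma r_X: "r \<subseteq> topspace X \<times> topspace X" and s_Y: "s \<subseteq> topspace Y \<times> topspace Y"
  using esakia_spaceD(2) X Y by auto

lemma clopen_upset_val: "set_hterm t \<subseteq> S \<Longrightarrow> clopen_upset X r (val t)"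
  using heval_closed[OF heyting_algebra_hclosed[OF upset_algebra_heyting_algebra[OF X]] f] by simp

lemma val_up: "t \<in> T \<Longrightarrow> x \<in> val t \<Longrightarrow> (x, x') \<in> r \<Longrightarrow> x' \<in> val t"
  using clopen_upset_val[OF T_S] by (auto simp: clopen_upset_def)

definition theory_of :: "'a \<Rightarrow> 'v hterm set" where
  "theory_of x = {t \<in> T. x \<in> val t}"

text \<open>Theories grow along \<open>r\<close>, so this bounds how many times a theory can still
  grow. It measures the depth of bisimilarity to be kept in reserve.\<close>

definition rank :: "'v hterm set \<Rightarrow> nat" where
  "rank \<Delta> = card (T - \<Delta>)"

lemma theory_of_mono: "(x, x') \<in> r \<Longrightarrow> theory_of x \<subseteq> theory_of x'"
  using val_up by (auto simp: theory_of_def)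

lemma rank_less: "(x, x') \<in> r \<Longrightarrow> theory_of x \<noteq> theory_of x' \<Longrightarrow> rank (theory_of x') < rank (theory_of x)"
  unfolding rank_def using finite_T theory_of_mono[of x x']
  by (intro psubset_card_mono) (auto simp: theory_of_def)

text \<open>
  Of the two witnesses, \<open>k'\<close> lifts steps of \<open>s\<close> to \<open>r\<close> (\<open>points_lift\<close>), whereas \<open>k\<close> matches
  steps of \<open>r\<close> by steps of \<open>s\<close> (the implication case of \<open>pval_T\<close>). A step that keeps the
  theory \<open>\<Delta>\<close> only replaces \<open>k\<close>, at the cost of one layer of \<open>k'\<close>; a step that enlarges it
  lowers the rank and so leaves two more layers to spend.
\<close>

definition points :: "('v hterm set \<times> 'b) set" where
  "points = {(\<Delta>, m). \<exists>k' k m'. (k', k) \<in> r \<and> (m', m) \<in> s \<and>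
     theory_of k' = \<Delta> \<and> theory_of k = \<Delta> \<and>
     layer s Q (2 * rank \<Delta> + 1) (g k') m' \<and> layer s Q (2 * rank \<Delta>) (g k) m}"

text \<open>Inclusion of theories takes the place of a step of \<open>r\<close> between witnesses.
  The points whose theory contains a given term thus form an up-set, and the second projection is
  monotone.\<close>

definition ord :: "('v hterm set \<times> 'b) rel" where
  "ord = {((\<Delta>, m), (\<Gamma>, n)). (\<Delta>, m) \<in> points \<and> (\<Gamma>, n) \<in> points \<and> \<Delta> \<subseteq> \<Gamma> \<and> (m, n) \<in> s}"

abbreviation alg :: "('v hterm set \<times> 'b) set heyting" where
  "alg \<equiv> upset_algebra (discrete_topology points) ord"

abbreviation pval :: "'v hterm \<Rightarrow> ('v hterm set \<times> 'b) set" where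
  "pval \<equiv> heval alg (\<lambda>v. {z \<in> points. Var v \<in> fst z})"

lemma points_Y: "z \<in> points \<Longrightarrow> snd z \<in> topspace Y"
  using s_Y by (auto simp: points_def)

lemma heyting_algebra_alg: "heyting_algebra alg"
proof (rule heyting_algebra_discrete)
  show "ord \<subseteq> points \<times> points" by (auto simp: ord_def)
  show "refl_on points ord"
    using points_Y esakia_spaceD(3)[OF Y] by (force simp: refl_on_def ord_def)
  show "trans ord"
    using transD[OF esakia_spaceD(4)[OF Y]] by (fastforce simp: trans_def ord_def)
qed

lemma pval_Var: "(\<lambda>v. {z \<in> points. Var v \<in> fst z}) \<in> S \<rightarrow> hcarrier alg"
  by (auto simp: clopen_upset_def clopenin_def ord_def)

text \<open>Taking \<open>k' = k\<close> and \<open>m' = m\<close>, the larger layer supplies both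
  conditions.\<close>

lemma pointI:
  assumes k: "k \<in> topspace X" and m: "m \<in> topspace Y"
    and l: "layer s Q (2 * rank (theory_of k) + 1) (g k) m"
  shows "(theory_of k, m) \<in> points"
  unfolding points_def
  using esakia_spaceD(3)[OF X k] esakia_spaceD(3)[OF Y m] l layer_antimono[OF _ l, of "2 * rank (theory_of k)"]
  by auto

text \<open>The lifting half of the claim that the second projection is a p-morphism to
  \<open>Y\<close>.\<close>

lemma points_lift:
  assumes z: "(\<Delta>, m) \<in> points" and n: "(m, n) \<in> s"
  shows "\<exists>\<Gamma>. ((\<Delta>, m), (\<Gamma>, n)) \<in> ord"
proof -
  obtain k' k m' where k: "(k', k) \<in> r" "(m', m) \<in> s" "theory_of k' = \<Delta>" "theory_of k = \<Delta>"
    "layer s Q (2 * rank \<Delta> + 1) (g k') m'"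
    using z by (auto simp: points_def)
  have m'n: "(m', n) \<in> s" using k(2) n transD[OF esakia_spaceD(4)[OF Y]] by blast
  have k'X: "k' \<in> topspace X" and nY: "n \<in> topspace Y" using k(1) n r_X s_Y by auto
  \<comment> \<open>One layer of the pair \<open>g k'\<close>, \<open>m'\<close> is spent on the
    step from \<open>m'\<close> to \<open>n\<close>.\<close>
  from k(5) m'n obtain y where y: "(g k', y) \<in> s" "layer s Q (2 * rank \<Delta>) y n" by auto
  then obtain h where h: "(k', h) \<in> r" "g h = y"
    using p_morphism_lift[OF g k'X _ y(1)] s_Y by blast
  have "(theory_of h, n) \<in> points"
  proof (cases "theory_of h = \<Delta>")
    case True
    \<comment> \<open>The pair \<open>k'\<close>, \<open>m'\<close> is kept at full depth and
      \<open>h\<close> becomes the new \<open>k\<close>.\<close>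
    then show ?thesis using k h y m'n by (auto simp: points_def)
  next
    case False
    then have "rank (theory_of h) < rank \<Delta>" using rank_less[OF h(1)] k(3) by auto
    then have "2 * rank (theory_of h) + 1 \<le> 2 * rank \<Delta>" by simp
    then have "layer s Q (2 * rank (theory_of h) + 1) (g h) n"
      unfolding h(2) by (rule layer_antimono[OF _ y(2)])
    then show ?thesis using h(1) r_X nY by (intro pointI) auto
  qed
  then show ?thesis
    using z n theory_of_mono[OF h(1)] k(3) by (auto simp: ord_def)
qed

text \<open>The truth lemma. In the implication case, membership in a theory is preserved by modus
  ponens in \<open>X\<close>, while a counterexample above \<open>k\<close> in \<open>X\<close> is
  carried to the model by a step of bisimilarity.\<close>

lemma pval_T:
  assumes "t \<in> T"
  shows "pval t = {z \<in> points. t \<in> fst z}"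
  using assms
proof (induction t)
  case (Imp D E)
  have DE: "D \<in> T" "E \<in> T" using T_subterms[OF Imp.prems] by auto
  have ev: "pval (Imp D E) =
      points - down ord ({z \<in> points. D \<in> fst z} - {z \<in> points. E \<in> fst z})"
    using Imp.IH DE by simp
  have valI: "val (Imp D E) = topspace X - down r (val D - val E)" by simp
  have "(\<Delta>, m) \<in> pval (Imp D E) \<longleftrightarrow> Imp D E \<in> \<Delta>" if z: "(\<Delta>, m) \<in> points" for \<Delta> m
  proof
    assume I: "Imp D E \<in> \<Delta>"
    have "E \<in> \<Gamma>" if o: "((\<Delta>, m), (\<Gamma>, n)) \<in> ord" and D: "D \<in> \<Gamma>" for \<Gamma> n
    proof -
      \<comment> \<open>Every theory in the model is that of an actual point of \<open>X\<close>,
        where modus ponens applies by reflexivity.\<close>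
      obtain h where h: "\<Gamma> = theory_of h" "h \<in> topspace X"
        using o r_X by (auto simp: ord_def points_def)
      have "Imp D E \<in> \<Gamma>" using o I by (auto simp: ord_def)
      then have "h \<in> val E"
        using h D esakia_spaceD(3)[OF X h(2)] by (auto simp: theory_of_def)
      then show ?thesis using h DE by (simp add: theory_of_def)
    qed
    then show "(\<Delta>, m) \<in> pval (Imp D E)" using z unfolding ev by auto
  next
    assume I: "(\<Delta>, m) \<in> pval (Imp D E)"
    show "Imp D E \<in> \<Delta>"
    proof (rule ccontr)
      assume neg: "Imp D E \<notin> \<Delta>"
      obtain k where k: "k \<in> topspace X" "theory_of k = \<Delta>" "layer s Q (2 * rank \<Delta>) (g k) m"
        using z r_X by (auto simp: points_def)
      have "k \<notin> val (Imp D E)" using neg k(2) Imp.prems by (auto simp: theory_of_def)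
      then obtain h where h: "(k, h) \<in> r" "h \<in> val D" "h \<notin> val E"
        using k(1) unfolding valI by auto
      have th: "D \<in> theory_of h" "E \<notin> theory_of h" using h DE by (auto simp: theory_of_def)
      have "\<exists>n. ((\<Delta>, m), (theory_of h, n)) \<in> ord"
      proof (cases "theory_of h = \<Delta>")
        case True
        \<comment> \<open>Here \<open>\<Delta>\<close> already contains \<open>D\<close> and omits
          \<open>E\<close>, so the reflexive step is a counterexample.\<close>
        then show ?thesis
          using z points_Y[OF z] esakia_spaceD(3)[OF Y] by (auto simp: ord_def)
      next
        case False
        then have less: "rank (theory_of h) < rank \<Delta>" using rank_less[OF h(1)] k(2) by auto
        then have "2 * rank \<Delta> = Suc (2 * rank \<Delta> - 1)" by simp
        then have l: "layer s Q (Suc (2 * rank \<Delta> - 1)) (g k) m" using k(3) by simp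
        have "(g k, g h) \<in> s" by (rule p_morphism_mono[OF g r_X h(1)])
        with l obtain n where n: "(m, n) \<in> s" "layer s Q (2 * rank \<Delta> - 1) (g h) n"
          unfolding layer.simps(2) by blast
        \<comment> \<open>The factor two is exact: a drop of the rank by one, after one layer is
          spent, leaves just the depth that \<open>pointI\<close> requires.\<close>
        have "2 * rank (theory_of h) + 1 \<le> 2 * rank \<Delta> - 1" using less by simp
        then have "layer s Q (2 * rank (theory_of h) + 1) (g h) n"
          by (rule layer_antimono[OF _ n(2)])
        then have "(theory_of h, n) \<in> points" using h(1) n(1) r_X s_Y by (intro pointI) auto
        then show ?thesis using z n(1) theory_of_mono[OF h(1)] k(2) by (auto simp: ord_def)
      qed
      then obtain n where n: "((\<Delta>, m), (theory_of h, n)) \<in> ord" by blast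
      then have "(theory_of h, n) \<in> points" by (auto simp: ord_def)
      then show False using I n th unfolding ev by auto
    qed
  qed
  moreover have "pval (Imp D E) \<subseteq> points" unfolding ev by auto
  ultimately show ?case by (auto simp del: heval.simps)
next
  case (Meet D E)
  then have DE: "D \<in> T" "E \<in> T" using T_subterms[OF Meet.prems] by auto
  have "Meet D E \<in> \<Delta> \<longleftrightarrow> D \<in> \<Delta> \<and> E \<in> \<Delta>" if "(\<Delta>, m) \<in> points" for \<Delta> m
    using that DE Meet.prems by (auto simp: points_def theory_of_def)
  then show ?case using Meet.IH DE by auto
next
  case (Join D E)
  then have DE: "D \<in> T" "E \<in> T" using T_subterms[OF Join.prems] by auto
  have "Join D E \<in> \<Delta> \<longleftrightarrow> D \<in> \<Delta> \<or> E \<in> \<Delta>" if "(\<Delta>, m) \<in> points" for \<Delta> m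
    using that DE Join.prems by (auto simp: points_def theory_of_def)
  then show ?case using Join.IH DE by auto
qed (use r_X in \<open>auto simp: points_def theory_of_def\<close>)

text \<open>One term describes both the preimage under \<open>g\<close> and the preimage under the
  second projection. Variables agree by layer zero and the truth lemma; implications are preserved
  because \<open>g\<close> is a p-morphism and by \<open>points_lift\<close>. Composite terms may
  lie outside \<open>T\<close>.\<close>

lemma preimage_term:
  assumes f': "\<And>j. j \<in> S' \<Longrightarrow> f' j \<in> Q"
      "\<And>j. j \<in> S' \<Longrightarrow> \<exists>t\<in>T. val t = g -` f' j \<inter> topspace X"
    and B: "f' \<in> S' \<rightarrow> hcarrier (upset_algebra Y s)" and u: "set_hterm u \<subseteq> S'"
  shows "\<exists>t. set_hterm t \<subseteq> S \<and> val t = g -` heval (upset_algebra Y s) f' u \<inter> topspace X \<and>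
    pval t = {z \<in> points. snd z \<in> heval (upset_algebra Y s) f' u}"
  using u
proof (induction u)
  case (Var j)
  then have j: "j \<in> S'" by simp
  obtain t where t: "t \<in> T" "val t = g -` f' j \<inter> topspace X" using f'(2)[OF j] by blast
  have "t \<in> \<Delta> \<longleftrightarrow> m \<in> f' j" if z: "(\<Delta>, m) \<in> points" for \<Delta> m
  proof -
    obtain k where k: "k \<in> topspace X" "theory_of k = \<Delta>" "layer s Q (2 * rank \<Delta>) (g k) m"
      using z r_X by (auto simp: points_def)
    then have "t \<in> \<Delta> \<longleftrightarrow> g k \<in> f' j" using t by (auto simp: theory_of_def)
    also have "\<dots> \<longleftrightarrow> m \<in> f' j" by (rule layer_zero[OF k(3) f'(1)[OF j]])
    finally show ?thesis .
  qed
  then have "pval t = {z \<in> points. snd z \<in> f' j}" using pval_T[OF t(1)] by auto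
  then show ?case using t T_S by (intro exI[of _ t]) simp
next
  case Bot
  show ?case by (rule exI[of _ Bot]) simp
next
  case Top
  have "g \<in> topspace X \<rightarrow> topspace Y" using g by (simp add: p_morphism_def)
  then show ?case using points_Y by (intro exI[of _ Top]) auto
next
  case (Meet u u')
  then obtain t t' where "set_hterm t \<subseteq> S" "val t = g -` heval (upset_algebra Y s) f' u \<inter> topspace X"
    "pval t = {z \<in> points. snd z \<in> heval (upset_algebra Y s) f' u}"
    "set_hterm t' \<subseteq> S" "val t' = g -` heval (upset_algebra Y s) f' u' \<inter> topspace X"
    "pval t' = {z \<in> points. snd z \<in> heval (upset_algebra Y s) f' u'}" by auto
  then show ?case by (intro exI[of _ "Meet t t'"]) auto
next
  case (Join u u')
  then obtain t t' where "set_hterm t \<subseteq> S" "val t = g -` heval (upset_algebra Y s) f' u \<inter> topspace X"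
    "pval t = {z \<in> points. snd z \<in> heval (upset_algebra Y s) f' u}"
    "set_hterm t' \<subseteq> S" "val t' = g -` heval (upset_algebra Y s) f' u' \<inter> topspace X"
    "pval t' = {z \<in> points. snd z \<in> heval (upset_algebra Y s) f' u'}" by auto
  then show ?case by (intro exI[of _ "Join t t'"]) auto
next
  case (Imp u u')
  let ?U = "heval (upset_algebra Y s) f' u" and ?V = "heval (upset_algebra Y s) f' u'"
  obtain t t' where t: "set_hterm t \<subseteq> S" "val t = g -` ?U \<inter> topspace X"
    "pval t = {z \<in> points. snd z \<in> ?U}"
    "set_hterm t' \<subseteq> S" "val t' = g -` ?V \<inter> topspace X"
    "pval t' = {z \<in> points. snd z \<in> ?V}" using Imp by auto
  have "clopen_upset Y s ?U"
    using heval_closed[OF heyting_algebra_hclosed[OF upset_algebra_heyting_algebra[OF Y]] B, of u]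
      Imp.prems by simp
  then have "?U - ?V \<subseteq> topspace Y"
    by (auto simp: clopen_upset_def clopenin_def dest: openin_subset)
  then have "down r (g -` (?U - ?V) \<inter> topspace X) = g -` (down s (?U - ?V)) \<inter> topspace X"
    using g unfolding p_morphism_def by blast
  moreover have "val t - val t' = g -` (?U - ?V) \<inter> topspace X" using t by auto
  ultimately have "val (Imp t t') = g -` heval (upset_algebra Y s) f' (Imp u u') \<inter> topspace X"
    using g by (auto simp: p_morphism_def)
  moreover have "pval (Imp t t') = {z \<in> points. snd z \<in> heval (upset_algebra Y s) f' (Imp u u')}"
  proof -
    have "z \<in> down ord (pval t - pval t') \<longleftrightarrow> snd z \<in> down s (?U - ?V)" if z: "z \<in> points" for z
    proof
      assume "z \<in> down ord (pval t - pval t')"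
      then show "snd z \<in> down s (?U - ?V)" using t(3,6) by (auto simp: ord_def)
    next
      assume "snd z \<in> down s (?U - ?V)"
      then obtain n where n: "(snd z, n) \<in> s" "n \<in> ?U" "n \<notin> ?V" by auto
      then obtain \<Gamma> where "(z, (\<Gamma>, n)) \<in> ord" using points_lift[of "fst z" "snd z" n] z by auto
      moreover from this have "(\<Gamma>, n) \<in> points" by (auto simp: ord_def)
      ultimately show "z \<in> down ord (pval t - pval t')" using n t(3,6) by auto
    qed
    then show ?thesis using points_Y by auto
  qed
  ultimately show ?case using t by (intro exI[of _ "Imp t t'"]) auto
qed

text \<open>The values of the terms true at \<open>z\<close> form a prime filter of clopen up-sets
  of \<open>X\<close>; \<open>ker\<close> makes truth at \<open>z\<close> depend only on the value
  of a term.\<close>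

lemma point_of_pval:
  assumes gen: "\<And>U. clopen_upset X r U \<Longrightarrow> \<exists>t. set_hterm t \<subseteq> S \<and> U = val t"
    and ker: "\<And>t u. set_hterm t \<subseteq> S \<Longrightarrow> set_hterm u \<subseteq> S \<Longrightarrow> val t = val u \<Longrightarrow> pval t = pval u"
    and z: "z \<in> points"
  obtains x where "x \<in> topspace X" "\<And>t. set_hterm t \<subseteq> S \<Longrightarrow> x \<in> val t \<longleftrightarrow> z \<in> pval t"
proof -
  define P where "P = {val t |t. set_hterm t \<subseteq> S \<and> z \<in> pval t}"
  have P: "val t \<in> P \<longleftrightarrow> z \<in> pval t" if t: "set_hterm t \<subseteq> S" for t
  proof
    assume "val t \<in> P"
    then obtain u where u: "set_hterm u \<subseteq> S" "z \<in> pval u" "val t = val u"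
      unfolding P_def by blast
    then show "z \<in> pval t" using ker[OF t u(1,3)] by blast
  next
    assume "z \<in> pval t"
    then show "val t \<in> P" using t unfolding P_def by blast
  qed
  have PE: "\<exists>t. set_hterm t \<subseteq> S \<and> U = val t \<and> z \<in> pval t" if "U \<in> P" for U
    using that unfolding P_def by blast
  obtain x where x: "x \<in> topspace X" "\<And>U. clopen_upset X r U \<Longrightarrow> x \<in> U \<longleftrightarrow> U \<in> P"
  proof (rule prime_filter_point[OF X, of P])
    show "clopen_upset X r U" if "U \<in> P" for U
      using PE[OF that] clopen_upset_val by blast
    show "topspace X \<in> P" using P[of Top] z by simp
    show "{} \<notin> P" using P[of Bot] by simp
    show "U \<inter> V \<in> P" if UV: "U \<in> P" "V \<in> P" for U V
    proof -
      obtain t u where "set_hterm t \<subseteq> S" "set_hterm u \<subseteq> S" "U = val t" "V = val u"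
        "z \<in> pval t" "z \<in> pval u" using PE[OF UV(1)] PE[OF UV(2)] by blast
      then show ?thesis using P[of "Meet t u"] by simp
    qed
    show "V \<in> P" if UV: "U \<in> P" "clopen_upset X r V" "U \<subseteq> V" for U V
    proof -
      obtain t u where tu: "set_hterm t \<subseteq> S" "set_hterm u \<subseteq> S" "U = val t" "V = val u"
        using PE[OF UV(1)] gen[OF UV(2)] by blast
      \<comment> \<open>The inclusion is rewritten as an equation, which \<open>ker\<close> carries
        over to the model.\<close>
      then have "val (Meet t u) = val t" using UV by auto
      then have "pval (Meet t u) = pval t" using tu by (intro ker) auto
      then show ?thesis using tu UV P[of t] P[of u] by auto
    qed
    show "U \<in> P \<or> V \<in> P"
      if UV: "clopen_upset X r U" "clopen_upset X r V" "U \<union> V \<in> P" for U V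
    proof -
      obtain t u where tu: "set_hterm t \<subseteq> S" "set_hterm u \<subseteq> S" "U = val t" "V = val u"
        using gen[OF UV(1)] gen[OF UV(2)] by blast
      then show ?thesis using UV P[of "Join t u"] P[of t] P[of u] by auto
    qed
  qed (rule that)
  show thesis
    by (rule that[OF x(1)]) (simp add: x(2) clopen_upset_val P)
qed

end

section \<open>Openness at each point of the image\<close>

theorem theorem2:
  fixes X :: "'a topology" and r :: "'a rel"
    and Y :: "'b topology" and s :: "'b rel"
    and g :: "'a \<Rightarrow> 'b"
  assumes "esakia_space X r" and "finitely_copresented X r"
    and "esakia_space Y s" and "finitely_copresented Y s"
    and "continuous_map X Y g" and "p_morphism X r Y s g"
  shows "open_map X Y g"
proof -
  let ?A = "upset_algebra X r" and ?B = "upset_algebra Y s"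
  have Acl: "hclosed ?A" and Bcl: "hclosed ?B"
    using assms(1,3) by (simp_all add: heyting_algebra_hclosed upset_algebra_heyting_algebra)
  obtain S :: "nat set" and f R where "finite S" and f: "f \<in> S \<rightarrow> hcarrier ?A"
    and genA: "\<And>U. U \<in> hcarrier ?A \<Longrightarrow> \<exists>t. set_hterm t \<subseteq> S \<and> U = heval ?A f t"
    and R: "finite R"
      "\<And>l u. (l, u) \<in> R \<Longrightarrow> set_hterm l \<subseteq> S \<and> set_hterm u \<subseteq> S \<and> heval ?A f l = heval ?A f u"
    and univ: "\<And>(H :: (nat hterm set \<times> 'b) set heyting) f' t u.
      heyting_algebra H \<Longrightarrow> f' \<in> S \<rightarrow> hcarrier H \<Longrightarrow>
      (\<forall>(l, u)\<in>R. heval H f' l = heval H f' u) \<Longrightarrow>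
      set_hterm t \<subseteq> S \<Longrightarrow> set_hterm u \<subseteq> S \<Longrightarrow> heval ?A f t = heval ?A f u \<Longrightarrow>
      heval H f' t = heval H f' u"
    by (rule finitely_presentedE[where ?'c = "(nat hterm set \<times> 'b) set",
          OF assms(2)[unfolded finitely_copresented_def] Acl]) (rule that)
  obtain S' :: "nat set" and f' where S': "finite S'" and f': "f' \<in> S' \<rightarrow> hcarrier ?B"
    and genB: "\<And>U. U \<in> hcarrier ?B \<Longrightarrow> \<exists>t. set_hterm t \<subseteq> S' \<and> U = heval ?B f' t"
    by (rule finitely_presentedE[OF assms(4)[unfolded finitely_copresented_def] Bcl]) (rule that)
  have genA': "\<exists>t. set_hterm t \<subseteq> S \<and> U = heval ?A f t" if "clopen_upset X r U" for U
    using genA that by simp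
  have gXY: "g \<in> topspace X \<rightarrow> topspace Y" using assms(6) by (simp add: p_morphism_def)
  \<comment> \<open>Layer zero is agreement on the generators of \<open>Y\<close>.\<close>
  define Q where "Q = f' ` S'"
  have Q: "finite Q" "\<forall>W\<in>Q. clopenin Y W"
    using S' f' by (auto simp: Q_def clopen_upset_def)
  have pre: "clopen_upset X r (g -` f' j \<inter> topspace X)" if j: "j \<in> S'" for j
  proof -
    have c: "clopenin Y (f' j)" "up s (f' j) \<subseteq> f' j" using f' j by (auto simp: clopen_upset_def)
    have "g -` f' j \<inter> topspace X = {x \<in> topspace X. g x \<in> f' j}" by auto
    then have "clopenin X (g -` f' j \<inter> topspace X)"
      using c(1) openin_continuous_map_preimage[OF assms(5)]
        closedin_continuous_map_preimage[OF assms(5)] by (simp add: clopenin_def)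
    moreover have "up r (g -` f' j \<inter> topspace X) \<subseteq> g -` f' j \<inter> topspace X"
    proof
      fix x' assume "x' \<in> up r (g -` f' j \<inter> topspace X)"
      then obtain x where x: "g x \<in> f' j" "(x, x') \<in> r" by auto
      have "(g x, g x') \<in> s"
        by (rule p_morphism_mono[OF assms(6) esakia_spaceD(2)[OF assms(1)] x(2)])
      then show "x' \<in> g -` f' j \<inter> topspace X"
        using x c(2) esakia_spaceD(2)[OF assms(1)] by auto
    qed
    ultimately show ?thesis by (simp add: clopen_upset_def)
  qed
  have "\<forall>j\<in>S'. \<exists>t. set_hterm t \<subseteq> S \<and> g -` f' j \<inter> topspace X = heval ?A f t"
    using genA'[OF pre] by blast
  then obtain \<tau> where \<tau>: "\<And>j. j \<in> S' \<Longrightarrow> set_hterm (\<tau> j) \<subseteq> S"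
      "\<And>j. j \<in> S' \<Longrightarrow> g -` f' j \<inter> topspace X = heval ?A f (\<tau> j)"
    unfolding bchoice_iff by blast
  have "\<exists>V. openin Y V \<and> y \<in> V \<and> V \<subseteq> g ` U" if U: "openin X U" and y: "y \<in> g ` U" for U y
  proof -
    obtain x where x: "x \<in> U" "y = g x" using y by blast
    have xX: "x \<in> topspace X" and yY: "y \<in> topspace Y"
      using x openin_subset[OF U] gXY by auto
    obtain \<W> where \<W>: "finite \<W>" "\<And>W. W \<in> \<W> \<Longrightarrow> clopen_upset X r W"
      "\<And>x'. x' \<in> topspace X \<Longrightarrow> (\<forall>W\<in>\<W>. x \<in> W \<longleftrightarrow> x' \<in> W) \<Longrightarrow> x' \<in> U"
      by (rule openin_determined_by_upsets[OF assms(1) U x(1)]) (rule that)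
    have "\<forall>W\<in>\<W>. \<exists>t. set_hterm t \<subseteq> S \<and> W = heval ?A f t"
      using genA'[OF \<W>(2)] by blast
    then obtain \<omega> where \<omega>: "\<And>W. W \<in> \<W> \<Longrightarrow> set_hterm (\<omega> W) \<subseteq> S" "\<And>W. W \<in> \<W> \<Longrightarrow> W = heval ?A f (\<omega> W)"
      unfolding bchoice_iff by blast
    define T0 where "T0 = fst ` R \<union> snd ` R \<union> \<tau> ` S' \<union> \<omega> ` \<W>"
    define T where "T = (\<Union>t\<in>T0. subterms t)"
    have RS: "set_hterm (fst p) \<subseteq> S \<and> set_hterm (snd p) \<subseteq> S" if "p \<in> R" for p
      using R(2)[of "fst p" "snd p"] that by simp
    have T0S: "set_hterm t \<subseteq> S" if "t \<in> T0" for t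
      using that RS \<tau>(1) \<omega>(1) unfolding T0_def by (elim UnE imageE) simp_all
    have T0T: "t \<in> T" if "t \<in> T0" for t
      unfolding T_def by (rule UN_I[OF that subterms_refl])
    interpret amalgam X r Y s g S f T Q
    proof
      show "finite T" using R(1) S' \<W>(1) by (simp add: T_def T0_def)
      show "subterms t \<subseteq> T" if "t \<in> T" for t
        using that subterms_trans unfolding T_def by blast
      show "set_hterm t \<subseteq> S" if "t \<in> T" for t
        using that set_hterm_subterms T0S unfolding T_def by blast
    qed fact+
    \<comment> \<open>Both sides have the same value in \<open>X\<close>, so they belong to the same
      theories, and the truth lemma transfers this to the model.\<close>
    have relations: "pval l = pval u" if lu: "(l, u) \<in> R" for l u
    proof -
      have m: "l \<in> T" "u \<in> T"
        using T0T[of "fst (l, u)"] T0T[of "snd (l, u)"] imageI[OF lu] unfolding T0_def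
        by (metis UnI1 UnI2 fst_conv snd_conv)+
      have "val l = val u" using R(2)[OF lu] by blast
      then have "l \<in> \<Delta> \<longleftrightarrow> u \<in> \<Delta>" if "(\<Delta>, m) \<in> points" for \<Delta> m
        using that m by (auto simp: points_def theory_of_def)
      then show ?thesis using pval_T[OF m(1)] pval_T[OF m(2)] by auto
    qed
    \<comment> \<open>Von Dyck's property extends the relations to all equations that hold in
      \<open>X\<close>, including those between terms outside \<open>T\<close>.\<close>
    have ker: "pval t = pval u"
      if "set_hterm t \<subseteq> S" "set_hterm u \<subseteq> S" "val t = val u" for t u
      by (rule univ[OF heyting_algebra_alg pval_Var _ that]) (use relations in auto)
    \<comment> \<open>The depth is the one at which \<open>pointI\<close> places
      \<open>theory_of x\<close> over every point of \<open>V\<close>.\<close>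
    obtain V where V: "openin Y V" "y \<in> V"
      "\<And>y'. y' \<in> V \<Longrightarrow> layer s Q (2 * rank (theory_of x) + 1) y y'"
      by (rule layer_neighbourhood[OF assms(3) Q yY, where n = "2 * rank (theory_of x) + 1"])
        (rule that)
    have "y' \<in> g ` U" if y': "y' \<in> V" for y'
    proof -
      have y'Y: "y' \<in> topspace Y" using y' V(1) openin_subset by blast
      have z: "(theory_of x, y') \<in> points"
        using pointI[OF xX y'Y] V(3)[OF y'] x(2) by simp
      obtain x' where x': "x' \<in> topspace X"
        "\<And>t. set_hterm t \<subseteq> S \<Longrightarrow> x' \<in> val t \<longleftrightarrow> (theory_of x, y') \<in> pval t"
        by (rule point_of_pval[OF genA' ker z]) (assumption | rule that)+
      \<comment> \<open>The chosen term for \<open>W\<close> lies in \<open>T\<close>, so its truth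
        at the model point is decided by the theory of \<open>x\<close>.\<close>
      have "x \<in> W \<longleftrightarrow> x' \<in> W" if W: "W \<in> \<W>" for W
      proof -
        have m: "\<omega> W \<in> T" using W by (intro T0T) (simp add: T0_def)
        have "x' \<in> W \<longleftrightarrow> (theory_of x, y') \<in> pval (\<omega> W)"
          using x'(2)[OF \<omega>(1)[OF W]] unfolding \<omega>(2)[OF W, symmetric] .
        also have "\<dots> \<longleftrightarrow> \<omega> W \<in> theory_of x"
          using pval_T[OF m] z by simp
        also have "\<dots> \<longleftrightarrow> x \<in> W"
          using m by (simp add: theory_of_def \<omega>(2)[OF W, symmetric])
        finally show ?thesis by blast
      qed
      then have x'U: "x' \<in> U" using \<W>(3)[OF x'(1)] by blast
      have "g x' = y'"
      proof (rule ccontr)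
        assume "g x' \<noteq> y'"
        \<comment> \<open>A separating \<open>C\<close> is the value of a term over
          \<open>Y\<close>. The term \<open>t\<close> given by \<open>preimage_term\<close> tests
          \<open>g x'\<close> in \<open>X\<close> and \<open>y'\<close> in the model, and
          \<open>x'\<close> agrees with the model point on all terms.\<close>
        then obtain C where C: "clopen_upset Y s C" "g x' \<in> C \<longleftrightarrow> y' \<notin> C"
          using esakia_space_separation[OF assms(3) _ y'Y] gXY x'(1) by blast
        obtain u where u: "set_hterm u \<subseteq> S'" "C = heval ?B f' u" using genB C(1) by auto
        have "\<exists>t\<in>T. val t = g -` f' j \<inter> topspace X" if "j \<in> S'" for j
          using \<tau>(2)[OF that] T0T[of "\<tau> j"] that by (auto simp: T0_def)
        then obtain t where t: "set_hterm t \<subseteq> S" "val t = g -` C \<inter> topspace X"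
          "pval t = {z \<in> points. snd z \<in> C}"
          using preimage_term[OF _ _ f' u(1)] u(2) by (auto simp: Q_def)
        have "g x' \<in> C \<longleftrightarrow> y' \<in> C"
          using x'(2)[OF t(1)] x'(1) z t(2,3) by simp
        then show False using C(2) by blast
      qed
      then show ?thesis using x'U by blast
    qed
    then show ?thesis using V by blast
  qed
  then show ?thesis
    unfolding open_map_def using openin_subopen by (metis (no_types, lifting))
qed

end
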